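(* Let $K$ be a finite simplicial complex with nonempty vertex set and $s\ge1$. Then for every integer $r\ge1$ the number of $(r,s)$-colorings of $K$ is \[ \chi^s(K,r)=\sum_{T\in L^s(K)}\mu(\emptyset,T)\,r^{|\pi(T)|}, \] where $\mu$ is the Möbius function of the poset $L^s(K)$.
   Context: An $s$-simplex of $K$ is a face with $s+1$ vertices; $F^s(K)$ is the set of them. An $(r,s)$-coloring is a map $V(K)\to\{1,\dots,r\}$ with no monochrome $s$-simplex, and $\chi^s(K,r)$ is their number. For $S\subseteq F^s(K)$: the connected components of $S$ are the equivalence classes of the smallest equivalence relation on $S$ relating simplices with nonempty intersection; $V(S)=\bigcup S$; $S$ is closed if $\{\sigma\in F^s(K)\mid\sigma\subseteq V(S)\}=S$; $\pi(S)$ is the partition of $V(K)$ whose blocks are the vertex sets of the connected components of $S$ together with the singletons $\{v\}$, $v\in V(K)\setminus V(S)$. $L^s(K)$ is the set of subsets of $F^s(K)$ all of whose connected components are closed, ordered by inclusion (a lattice with least element $\emptyset$). *)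

theory Defs
  imports Main "HOL-Library.FuncSet"
begin

text \<open>Abstract simplicial complexes, given by their set of faces. Only nonempty subsets of
  faces are required to be faces, so both conventions for the empty face are admitted; every
  element of \<open>\<Union>K\<close> is automatically a vertex (\<open>{v} \<in> K\<close>).\<close>

definition simplicial_complex :: "'a set set \<Rightarrow> bool" where
  "simplicial_complex K \<longleftrightarrow>
     (\<forall>\<sigma>\<in>K. finite \<sigma> \<and> (\<forall>\<tau>. \<tau> \<subseteq> \<sigma> \<and> \<tau> \<noteq> {} \<longrightarrow> \<tau> \<in> K))"

definition vertices :: "'a set set \<Rightarrow> 'a set" where
  "vertices K = \<Union>K"

definition simplices :: "nat \<Rightarrow> 'a set set \<Rightarrow> 'a set set" where
  "simplices s K = {\<sigma> \<in> K. card \<sigma> = s + 1}"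

definition monochrome :: "('a \<Rightarrow> nat) \<Rightarrow> 'a set \<Rightarrow> bool" where
  "monochrome f \<sigma> \<longleftrightarrow> (\<exists>c. \<forall>v\<in>\<sigma>. f v = c)"

text \<open>Colorings are taken as extensional functions on the vertex set, so that they can be counted.\<close>

definition colorings :: "nat \<Rightarrow> nat \<Rightarrow> 'a set set \<Rightarrow> ('a \<Rightarrow> nat) set" where
  "colorings r s K = {f \<in> vertices K \<rightarrow>\<^sub>E {1..r}. \<not> (\<exists>\<sigma>\<in>simplices s K. monochrome f \<sigma>)}"

definition num_colorings :: "nat \<Rightarrow> 'a set set \<Rightarrow> nat \<Rightarrow> nat" where
  "num_colorings s K r = card (colorings r s K)"

definition connectedness :: "'a set set \<Rightarrow> ('a set \<times> 'a set) set" where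
  "connectedness S = \<Inter>{R. equiv S R \<and> (\<forall>\<sigma>\<in>S. \<forall>\<tau>\<in>S. \<sigma> \<inter> \<tau> \<noteq> {} \<longrightarrow> (\<sigma>, \<tau>) \<in> R)}"

definition conn_components :: "'a set set \<Rightarrow> 'a set set set" where
  "conn_components S = S // connectedness S"

definition closed_simplices :: "nat \<Rightarrow> 'a set set \<Rightarrow> 'a set set \<Rightarrow> bool" where
  "closed_simplices s K S \<longleftrightarrow> {\<sigma> \<in> simplices s K. \<sigma> \<subseteq> vertices S} = S"

definition block_partition :: "'a set set \<Rightarrow> 'a set set \<Rightarrow> 'a set set" where
  "block_partition K S = vertices ` conn_components S \<union> {{v} |v. v \<in> vertices K - vertices S}"

definition chromatic_lattice :: "nat \<Rightarrow> 'a set set \<Rightarrow> 'a set set set" where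
  "chromatic_lattice s K =
     {S. S \<subseteq> simplices s K \<and> (\<forall>C\<in>conn_components S. closed_simplices s K C)}"

text \<open>The Moebius function of a locally finite poset \<open>P\<close> with the order of the ambient type,
  extended by \<open>0\<close>; for \<open>x < y\<close> the recursion says that \<open>mobius P x z\<close> sums to \<open>0\<close> over
  the interval from \<open>x\<close> to \<open>y\<close> in \<open>P\<close>.\<close>

function mobius :: "'b::order set \<Rightarrow> 'b \<Rightarrow> 'b \<Rightarrow> int" where
  "mobius P x y =
     (if x \<in> P \<and> y \<in> P \<and> x \<le> y \<and> finite {z \<in> P. x \<le> z \<and> z \<le> y}
      then if x = y then 1 else - (\<Sum>z \<in> {z \<in> P. x \<le> z \<and> z < y}. mobius P x z)
      else 0)"
  by pat_completeness auto

termination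
proof (relation "measure (\<lambda>(P, x, y). card {z \<in> P. x \<le> z \<and> z \<le> y})")
  show "wf (measure (\<lambda>(P, x, y). card {z \<in> P. x \<le> z \<and> z \<le> y}))"
    by simp
next
  fix P and x y z :: "'b::order"
  assume a: "x \<in> P \<and> y \<in> P \<and> x \<le> y \<and> finite {z \<in> P. x \<le> z \<and> z \<le> y}"
    and z: "z \<in> {z \<in> P. x \<le> z \<and> z < y}"
  have "{w \<in> P. x \<le> w \<and> w \<le> z} \<subseteq> {w \<in> P. x \<le> w \<and> w \<le> y}"
    using z by auto
  moreover have "y \<in> {w \<in> P. x \<le> w \<and> w \<le> y}" "y \<notin> {w \<in> P. x \<le> w \<and> w \<le> z}"
    using a z by auto
  ultimately have "{w \<in> P. x \<le> w \<and> w \<le> z} \<subset> {w \<in> P. x \<le> w \<and> w \<le> y}"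
    by blast
  then show "((P, x, z), (P, x, y)) \<in> measure (\<lambda>(P, x, y). card {z \<in> P. x \<le> z \<and> z \<le> y})"
    using a by (simp add: psubset_card_mono)
qed

declare mobius.simps [simp del]

end

theory Submission
  imports Defs "HOL-Library.Disjoint_Sets"
begin

text \<open>The monochrome simplices of an arbitrary map from the vertices to the colors form an element
  of the lattice: any simplex spanned by the vertices of a connected monochrome family is itself
  monochrome. Colorings are the maps for which this element is \<open>\<emptyset>\<close>, so Moebius inversion
  expresses their number through the numbers of maps whose monochrome simplices include a given \<open>T\<close>
  in the lattice. These are the maps that are constant on the blocks of \<open>\<pi>(T)\<close>.\<close>

lemma sum_mobius_interval:
  assumes "x \<in> P" "y \<in> P" "x \<le> y" "finite {z \<in> P. x \<le> z \<and> z \<le> y}"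
  shows "(\<Sum>z | z \<in> P \<and> x \<le> z \<and> z \<le> y. mobius P x z) = (if x = y then 1 else 0)"
proof -
  have interval: "{z \<in> P. x \<le> z \<and> z \<le> y} = insert y {z \<in> P. x \<le> z \<and> z < y}"
    using assms by auto
  then have "finite {z \<in> P. x \<le> z \<and> z < y}"
    using assms(4) by simp
  then have top_split: "(\<Sum>z | z \<in> P \<and> x \<le> z \<and> z \<le> y. mobius P x z)
      = mobius P x y + (\<Sum>z | z \<in> P \<and> x \<le> z \<and> z < y. mobius P x z)"
    unfolding interval by simp
  show ?thesis
  proof (cases "x = y")
    case True
    then have "(\<Sum>z | z \<in> P \<and> x \<le> z \<and> z < y. mobius P x z) = 0"
      by (intro sum.neutral) auto
    moreover have "mobius P x y = 1"
      using assms True by (subst mobius.simps) simp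
    ultimately show ?thesis
      using top_split True by simp
  next
    case False
    then have "mobius P x y = - (\<Sum>z | z \<in> P \<and> x \<le> z \<and> z < y. mobius P x z)"
      using assms by (subst mobius.simps) simp
    with top_split False show ?thesis
      by simp
  qed
qed

lemma mobius_inversion_upper:
  fixes f g :: "'a::order \<Rightarrow> 'b::ring_1"
  assumes x: "x \<in> P" and fin: "finite {z \<in> P. x \<le> z}"
    and g: "\<And>y. y \<in> P \<Longrightarrow> x \<le> y \<Longrightarrow> g y = (\<Sum>z | z \<in> P \<and> y \<le> z. f z)"
  shows "f x = (\<Sum>y | y \<in> P \<and> x \<le> y. of_int (mobius P x y) * g y)"
proof -
  define U where "U = {z \<in> P. x \<le> z}"
  have finU: "finite U"
    unfolding U_def by (rule fin)
  have interval: "{y \<in> U. y \<le> z} = {y \<in> P. x \<le> y \<and> y \<le> z}" for z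
    unfolding U_def by auto
  have interval_sum: "(\<Sum>y | y \<in> U \<and> y \<le> z. mobius P x y) = (if x = z then 1 else 0)"
    if "z \<in> U" for z
  proof -
    have "finite {y \<in> P. x \<le> y \<and> y \<le> z}"
      using finU by (simp flip: interval)
    then show ?thesis
      using sum_mobius_interval[OF x, of z] that unfolding interval by (simp add: U_def)
  qed
  have "{z \<in> U. y \<le> z} = {z \<in> P. y \<le> z}" if "y \<in> U" for y
    using that unfolding U_def by auto
  then have upper_sum: "g y = (\<Sum>z | z \<in> U \<and> y \<le> z. f z)" if "y \<in> U" for y
    using g that unfolding U_def by simp
  have "(\<Sum>y\<in>U. of_int (mobius P x y) * g y)
      = (\<Sum>y\<in>U. \<Sum>z | z \<in> U \<and> y \<le> z. of_int (mobius P x y) * f z)"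
    by (simp add: upper_sum sum_distrib_left)
  also have "\<dots> = (\<Sum>z\<in>U. \<Sum>y | y \<in> U \<and> y \<le> z. of_int (mobius P x y) * f z)"
    by (rule sum.swap_restrict[OF finU finU])
  also have "\<dots> = (\<Sum>z\<in>U. of_int (\<Sum>y | y \<in> U \<and> y \<le> z. mobius P x y) * f z)"
    by (simp add: sum_distrib_right)
  also have "\<dots> = (\<Sum>z\<in>U. if x = z then f z else 0)"
    by (intro sum.cong) (simp_all add: interval_sum)
  also have "\<dots> = f x"
    using finU x by (simp add: U_def)
  finally show ?thesis
    unfolding U_def by simp
qed

corollary card_fibre_eq_sum_mobius:
  fixes m :: "'a \<Rightarrow> 'b::order"
  assumes "finite A" "finite P" "m ` A \<subseteq> P" "x \<in> P"
  shows "int (card {a \<in> A. m a = x})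
    = (\<Sum>y | y \<in> P \<and> x \<le> y. mobius P x y * int (card {a \<in> A. y \<le> m a}))"
proof -
  have "int (card {a \<in> A. y \<le> m a}) = (\<Sum>z | z \<in> P \<and> y \<le> z. int (card {a \<in> A. m a = z}))" for y
  proof -
    have "(\<Sum>z | z \<in> P \<and> y \<le> z. card {a \<in> {a \<in> A. y \<le> m a}. m a = z}) = card {a \<in> A. y \<le> m a}"
      using sum.group[of "{a \<in> A. y \<le> m a}" "{z \<in> P. y \<le> z}" m "\<lambda>_. 1 :: nat"] assms(1-3)
      by auto
    moreover have "{a \<in> {a \<in> A. y \<le> m a}. m a = z} = {a \<in> A. m a = z}" if "y \<le> z" for z
      using that by auto
    ultimately show ?thesis
      by (simp flip: of_nat_sum)
  qed
  from mobius_inversion_upper[OF \<open>x \<in> P\<close> _ this] \<open>finite P\<close> show ?thesis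
    by simp
qed

lemma image_equiv_class:
  assumes "equiv A r" "f respects r" "x \<in> A"
  shows "f ` (r `` {x}) = {f x}"
proof -
  have "f y = f x" if "y \<in> r `` {x}" for y
    using congruentD[OF assms(2), of x y] that by simp
  then show ?thesis
    using equiv_class_self[OF assms(1,3)] by blast
qed

lemma bij_betw_PiE_quotient:
  assumes r: "equiv A r"
  shows "bij_betw (\<lambda>g. \<lambda>x\<in>A. g (r `` {x})) (A // r \<rightarrow>\<^sub>E B) {f \<in> A \<rightarrow>\<^sub>E B. f respects r}"
proof (intro bij_betwI[where g = "\<lambda>f. \<lambda>X\<in>A // r. the_elem (f ` X)"] funcsetI CollectI conjI)
  fix g assume g: "g \<in> A // r \<rightarrow>\<^sub>E B"
  show "(\<lambda>x\<in>A. g (r `` {x})) \<in> A \<rightarrow>\<^sub>E B"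
    using g by (auto intro: quotientI)
  show respects: "(\<lambda>x\<in>A. g (r `` {x})) respects r"
    by (rule congruentI) (use equiv_class_eq_iff[OF r] in simp)
  show "(\<lambda>X\<in>A // r. the_elem ((\<lambda>x\<in>A. g (r `` {x})) ` X)) = g"
  proof (rule extensionalityI)
    fix X assume "X \<in> A // r"
    then obtain x where "x \<in> A" "X = r `` {x}"
      by (rule quotientE)
    then show "(\<lambda>X\<in>A // r. the_elem ((\<lambda>x\<in>A. g (r `` {x})) ` X)) X = g X"
      using image_equiv_class[OF r respects] \<open>X \<in> A // r\<close> by simp
  qed (use g in \<open>auto simp: PiE_iff\<close>)
next
  fix f assume "f \<in> {f \<in> A \<rightarrow>\<^sub>E B. f respects r}"
  then have f: "f \<in> A \<rightarrow>\<^sub>E B" "f respects r"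
    by auto
  then show "(\<lambda>X\<in>A // r. the_elem (f ` X)) \<in> A // r \<rightarrow>\<^sub>E B"
    using image_equiv_class[OF r f(2)] by (fastforce elim: quotientE)
  show "(\<lambda>x\<in>A. (\<lambda>X\<in>A // r. the_elem (f ` X)) (r `` {x})) = f"
  proof (rule extensionalityI)
    fix x assume "x \<in> A"
    then show "(\<lambda>x\<in>A. (\<lambda>X\<in>A // r. the_elem (f ` X)) (r `` {x})) x = f x"
      using image_equiv_class[OF r f(2)] by (simp add: quotientI)
  qed (use f in \<open>auto simp: PiE_iff\<close>)
qed

corollary card_PiE_respects:
  assumes "equiv A r" "finite (A // r)"
  shows "card {f \<in> A \<rightarrow>\<^sub>E B. f respects r} = card B ^ card (A // r)"
  using bij_betw_same_card[OF bij_betw_PiE_quotient[OF assms(1)], of B] card_PiE[OF assms(2), of "\<lambda>_. B"]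
  by simp

corollary card_PiE_constant_on_parts:
  assumes part: "partition_on A P" and fin: "finite P"
  shows "card {f \<in> A \<rightarrow>\<^sub>E B. \<forall>p\<in>P. \<forall>x\<in>p. \<forall>y\<in>p. f x = f y} = card B ^ card P"
proof -
  have "(\<forall>p\<in>P. \<forall>x\<in>p. \<forall>y\<in>p. f x = f y) \<longleftrightarrow> f respects {(x, y). \<exists>p\<in>P. x \<in> p \<and> y \<in> p}"
    for f :: "'a \<Rightarrow> 'b"
    unfolding congruent_def by blast
  then show ?thesis
    using card_PiE_respects[OF equiv_partition_on[OF part], of B] fin
    by (simp add: partition_on_eq_quotient[OF part])
qed

lemma partition_on_Un:
  assumes "partition_on A P" "partition_on B Q" "A \<inter> B = {}"
  shows "partition_on (A \<union> B) (P \<union> Q)"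
  using assms disjoint_union[of P Q] by (auto simp: partition_on_def)

lemma equiv_Inter:
  assumes "F \<noteq> {}" and "\<And>R. R \<in> F \<Longrightarrow> equiv A R"
  shows "equiv A (\<Inter>F)"
proof (rule equivI)
  show "\<Inter>F \<subseteq> A \<times> A"
    using assms equiv_type by blast
  show "refl_on A (\<Inter>F)"
    using assms(2) by (auto simp: equiv_def refl_on_def)
  show "sym (\<Inter>F)"
    using assms(2) by (auto simp: equiv_def intro!: symI dest: symD)
  show "trans (\<Inter>F)"
    using assms(2) by (blast intro: transI elim: equivE dest: transD)
qed

lemma equiv_connectedness: "equiv S (connectedness S)"
  unfolding connectedness_def
proof (rule equiv_Inter)
  have "equiv S (S \<times> S)"
    by (auto intro!: equivI refl_onI symI transI)
  then show "{R. equiv S R \<and> (\<forall>\<sigma>\<in>S. \<forall>\<tau>\<in>S. \<sigma> \<inter> \<tau> \<noteq> {} \<longrightarrow> (\<sigma>, \<tau>) \<in> R)} \<noteq> {}"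
    by blast
qed blast

lemma connectedness_if_intersecting:
  "\<sigma> \<in> S \<Longrightarrow> \<tau> \<in> S \<Longrightarrow> \<sigma> \<inter> \<tau> \<noteq> {} \<Longrightarrow> (\<sigma>, \<tau>) \<in> connectedness S"
  by (auto simp: connectedness_def)

lemma respects_connectednessI:
  assumes "\<And>\<sigma> \<tau>. \<sigma> \<in> S \<Longrightarrow> \<tau> \<in> S \<Longrightarrow> \<sigma> \<inter> \<tau> \<noteq> {} \<Longrightarrow> h \<sigma> = h \<tau>"
  shows "h respects (connectedness S)"
proof -
  have "equiv S {(\<sigma>, \<tau>) \<in> S \<times> S. h \<sigma> = h \<tau>}"
    by (auto intro!: equivI refl_onI symI transI)
  then have "connectedness S \<subseteq> {(\<sigma>, \<tau>) \<in> S \<times> S. h \<sigma> = h \<tau>}"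
    unfolding connectedness_def using assms by (intro Inter_lower) simp
  then show ?thesis
    by (auto intro: congruentI)
qed

lemma partition_on_conn_components: "partition_on S (conn_components S)"
  unfolding conn_components_def by (rule partition_on_quotient[OF equiv_connectedness])

lemma Union_conn_components: "\<Union>(conn_components S) = S"
  using partition_onD1[OF partition_on_conn_components] by (rule sym)

lemma mem_conn_component_if_meets:
  assumes C: "C \<in> conn_components S" and "\<sigma> \<in> S" "\<sigma> \<inter> vertices C \<noteq> {}"
  shows "\<sigma> \<in> C"
proof -
  obtain \<tau> where \<tau>: "\<tau> \<in> C" "\<tau> \<inter> \<sigma> \<noteq> {}"
    using assms(3) unfolding vertices_def by blast
  then have "(\<tau>, \<sigma>) \<in> connectedness S"
    using C \<open>\<sigma> \<in> S\<close> Union_conn_components by (blast intro: connectedness_if_intersecting)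
  then show ?thesis
    using in_quotient_imp_closed[OF equiv_connectedness] C \<tau>(1) unfolding conn_components_def
    by metis
qed

lemma disjnt_vertices_conn_components:
  assumes C: "C \<in> conn_components S" and D: "D \<in> conn_components S" and "C \<noteq> D"
  shows "disjnt (vertices C) (vertices D)"
proof -
  have "\<sigma> \<inter> vertices D = {}" if "\<sigma> \<in> C" for \<sigma>
  proof -
    have "\<sigma> \<in> S"
      using that C Union_conn_components by blast
    moreover have "\<sigma> \<notin> D"
      using that assms partition_onD2[OF partition_on_conn_components] by (auto simp: disjoint_def)
    ultimately show ?thesis
      using mem_conn_component_if_meets[OF D] by blast
  qed
  then show ?thesis
    by (auto simp: disjnt_def vertices_def[of C])
qed

lemma partition_on_vertices_conn_components:
  assumes "{} \<notin> S"
  shows "partition_on (vertices S) (vertices ` conn_components S)"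
proof (rule partition_onI)
  show "\<Union>(vertices ` conn_components S) = vertices S"
    using Union_conn_components[of S] by (auto simp: vertices_def)
next
  fix p q
  assume "p \<in> vertices ` conn_components S" "q \<in> vertices ` conn_components S" "p \<noteq> q"
  then show "disjnt p q"
    using disjnt_vertices_conn_components by blast
next
  have "vertices C \<noteq> {}" if "C \<in> conn_components S" for C
  proof -
    have "C \<noteq> {}"
      using that partition_onD3[OF partition_on_conn_components] by blast
    moreover have "{} \<notin> C"
      using that assms Union_conn_components by blast
    ultimately show ?thesis
      unfolding vertices_def by auto
  qed
  then show "{} \<notin> vertices ` conn_components S"
    by auto
qed

lemma partition_on_block_partition:
  assumes "S \<subseteq> K" "{} \<notin> S"
  shows "partition_on (vertices K) (block_partition K S)"
proof -
  have "vertices K = vertices S \<union> (vertices K - vertices S)"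
    using assms(1) by (auto simp: vertices_def)
  moreover have "block_partition K S
      = vertices ` conn_components S \<union> (\<lambda>v. {v}) ` (vertices K - vertices S)"
    unfolding block_partition_def by blast
  ultimately show ?thesis
    using partition_on_Un[OF partition_on_vertices_conn_components[OF assms(2)] partition_on_singletons,
        of "vertices K - vertices S"]
    by simp
qed

lemma monochrome_iff: "monochrome f \<sigma> \<longleftrightarrow> (\<forall>x\<in>\<sigma>. \<forall>y\<in>\<sigma>. f x = f y)"
  unfolding monochrome_def by metis

lemma monochrome_subset: "monochrome f \<sigma> \<Longrightarrow> \<tau> \<subseteq> \<sigma> \<Longrightarrow> monochrome f \<tau>"
  unfolding monochrome_def by blast

lemma monochrome_vertices_conn_component:
  assumes mono: "\<And>\<sigma>. \<sigma> \<in> S \<Longrightarrow> monochrome f \<sigma>" and C: "C \<in> conn_components S"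
  shows "monochrome f (vertices C)"
  unfolding monochrome_iff
proof (intro ballI)
  fix x y assume "x \<in> vertices C" "y \<in> vertices C"
  then obtain \<sigma> \<tau> where \<sigma>: "\<sigma> \<in> C" "x \<in> \<sigma>" and \<tau>: "\<tau> \<in> C" "y \<in> \<tau>"
    unfolding vertices_def by blast
  have "(\<lambda>\<sigma>. f ` \<sigma>) respects (connectedness S)"
  proof (rule respects_connectednessI)
    fix \<sigma> \<tau> assume "\<sigma> \<in> S" "\<tau> \<in> S" "\<sigma> \<inter> \<tau> \<noteq> {}"
    then obtain v where "v \<in> \<sigma>" "v \<in> \<tau>"
      by blast
    then have "f ` \<sigma> = {f v}" "f ` \<tau> = {f v}"
      using mono[OF \<open>\<sigma> \<in> S\<close>] mono[OF \<open>\<tau> \<in> S\<close>] unfolding monochrome_def by auto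
    then show "f ` \<sigma> = f ` \<tau>"
      by simp
  qed
  moreover have "(\<sigma>, \<tau>) \<in> connectedness S"
    using in_quotient_imp_in_rel[OF equiv_connectedness] C \<sigma>(1) \<tau>(1)
    unfolding conn_components_def by blast
  ultimately have "f ` \<sigma> = f ` \<tau>"
    by (rule congruentD)
  then obtain v where v: "v \<in> \<tau>" "f x = f v"
    using \<sigma>(2) by blast
  have "monochrome f \<tau>"
    using mono C \<tau>(1) Union_conn_components by blast
  then have "f v = f y"
    using v(1) \<tau>(2) unfolding monochrome_iff by blast
  with v(2) show "f x = f y"
    by simp
qed

lemma monochrome_blocks_iff:
  "(\<forall>p\<in>block_partition K S. monochrome f p) \<longleftrightarrow> (\<forall>\<sigma>\<in>S. monochrome f \<sigma>)"
proof (intro iffI ballI)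
  fix \<sigma> assume blocks: "\<forall>p\<in>block_partition K S. monochrome f p" and "\<sigma> \<in> S"
  then obtain C where C: "C \<in> conn_components S" "\<sigma> \<in> C"
    using Union_conn_components by blast
  then have "monochrome f (vertices C)"
    using blocks unfolding block_partition_def by blast
  then show "monochrome f \<sigma>"
    by (rule monochrome_subset) (use C in \<open>auto simp: vertices_def\<close>)
next
  fix p assume mono: "\<forall>\<sigma>\<in>S. monochrome f \<sigma>" and "p \<in> block_partition K S"
  then consider (component) C where "C \<in> conn_components S" "p = vertices C"
    | (singleton) v where "p = {v}"
    unfolding block_partition_def by blast
  then show "monochrome f p"
  proof cases
    case component
    with mono show ?thesis
      using monochrome_vertices_conn_component[of S f C] by simp
  next
    case singleton
    then show ?thesis
      by (simp add: monochrome_iff)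
  qed
qed

lemma empty_notin_simplices: "{} \<notin> simplices s K"
  by (simp add: simplices_def)

definition monochrome_simplices :: "nat \<Rightarrow> 'a set set \<Rightarrow> ('a \<Rightarrow> nat) \<Rightarrow> 'a set set" where
  "monochrome_simplices s K f = {\<sigma> \<in> simplices s K. monochrome f \<sigma>}"

lemma colorings_eq: "colorings r s K = {f \<in> vertices K \<rightarrow>\<^sub>E {1..r}. monochrome_simplices s K f = {}}"
  by (auto simp: colorings_def monochrome_simplices_def)

lemma monochrome_simplices_in_chromatic_lattice:
  "monochrome_simplices s K f \<in> chromatic_lattice s K" (is "?M \<in> _")
proof -
  have "\<sigma> \<in> C \<longleftrightarrow> \<sigma> \<in> simplices s K \<and> \<sigma> \<subseteq> vertices C" if C: "C \<in> conn_components ?M" for C \<sigma>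
  proof
    assume "\<sigma> \<in> C"
    then show "\<sigma> \<in> simplices s K \<and> \<sigma> \<subseteq> vertices C"
      using C Union_conn_components[of ?M] by (auto simp: vertices_def monochrome_simplices_def)
  next
    assume \<sigma>: "\<sigma> \<in> simplices s K \<and> \<sigma> \<subseteq> vertices C"
    have "monochrome f (vertices C)"
      by (rule monochrome_vertices_conn_component[OF _ C]) (simp add: monochrome_simplices_def)
    then have "\<sigma> \<in> ?M"
      using \<sigma> monochrome_subset by (auto simp: monochrome_simplices_def)
    moreover have "\<sigma> \<inter> vertices C \<noteq> {}"
      using \<sigma> empty_notin_simplices by (metis inf.absorb1)
    ultimately show "\<sigma> \<in> C"
      by (rule mem_conn_component_if_meets[OF C])
  qed
  then show ?thesis
    unfolding chromatic_lattice_def closed_simplices_def by (auto simp: monochrome_simplices_def)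
qed

lemma empty_in_chromatic_lattice: "{} \<in> chromatic_lattice s K"
  by (simp add: chromatic_lattice_def conn_components_def)

lemma chromatic_lattice_imp_subset_simplices: "T \<in> chromatic_lattice s K \<Longrightarrow> T \<subseteq> simplices s K"
  by (simp add: chromatic_lattice_def)

lemma finite_chromatic_lattice:
  assumes "finite K"
  shows "finite (chromatic_lattice s K)"
proof (rule finite_subset)
  show "chromatic_lattice s K \<subseteq> Pow (simplices s K)"
    using chromatic_lattice_imp_subset_simplices by blast
  show "finite (Pow (simplices s K))"
    using assms by (simp add: simplices_def)
qed

lemma card_monochrome_simplices_above:
  assumes fin: "finite (vertices K)" and T: "T \<subseteq> simplices s K"
  shows "card {f \<in> vertices K \<rightarrow>\<^sub>E C. T \<subseteq> monochrome_simplices s K f}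
    = card C ^ card (block_partition K T)"
proof -
  have "T \<subseteq> K" "{} \<notin> T"
    using T empty_notin_simplices by (auto simp: simplices_def)
  then have part: "partition_on (vertices K) (block_partition K T)"
    by (rule partition_on_block_partition)
  have "T \<subseteq> monochrome_simplices s K f \<longleftrightarrow> (\<forall>p\<in>block_partition K T. monochrome f p)" for f
    using T by (auto simp: monochrome_blocks_iff monochrome_simplices_def)
  then show ?thesis
    using card_PiE_constant_on_parts[OF part finite_elements[OF fin part], of C]
    by (simp add: monochrome_iff)
qed

lemma finite_vertices: "simplicial_complex K \<Longrightarrow> finite K \<Longrightarrow> finite (vertices K)"
  by (auto simp: vertices_def simplicial_complex_def)

theorem theorem2p24:
  fixes K :: "'a set set" and s r :: nat
  assumes "simplicial_complex K" and "finite K" and "vertices K \<noteq> {}"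
    and "s \<ge> 1" and "r \<ge> 1"
  shows "int (num_colorings s K r) =
    (\<Sum>T \<in> chromatic_lattice s K.
       mobius (chromatic_lattice s K) {} T * int r ^ card (block_partition K T))"
proof -
  let ?L = "chromatic_lattice s K" and ?M = "monochrome_simplices s K"
    and ?F = "vertices K \<rightarrow>\<^sub>E {1..r}"
  have fin_vertices: "finite (vertices K)"
    using assms(1,2) by (rule finite_vertices)
  then have fin_maps: "finite ?F"
    by (simp add: finite_PiE)
  have lattice: "finite ?L" "?M ` ?F \<subseteq> ?L" "{} \<in> ?L"
    using finite_chromatic_lattice[OF assms(2)] monochrome_simplices_in_chromatic_lattice
      empty_in_chromatic_lattice by blast+
  have "int (num_colorings s K r) = int (card {f \<in> ?F. ?M f = {}})"
    by (simp add: num_colorings_def colorings_eq)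
  also have "\<dots> = (\<Sum>T\<in>?L. mobius ?L {} T * int (card {f \<in> ?F. T \<subseteq> ?M f}))"
    using card_fibre_eq_sum_mobius[OF fin_maps lattice] by simp
  also have "\<dots> = (\<Sum>T\<in>?L. mobius ?L {} T * int r ^ card (block_partition K T))"
    by (simp add: card_monochrome_simplices_above[OF fin_vertices chromatic_lattice_imp_subset_simplices])
  finally show ?thesis .
qed

end
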